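(* Let $\mathbb{D}\subset\mathbb{R}^2$ be the open unit disc equipped with Lebesgue measure. There exist a Borel measurable map $\varphi:\overline{\mathbb{D}}\to\mathbb{R}^2$ and a countable discrete set $\Lambda\subset\mathbb{R}^2$ such that $E(\Lambda,\varphi)=\{e^{2\pi i\lambda\cdot\varphi(x)}:\lambda\in\Lambda\}$ forms an orthogonal basis for $L^2(\mathbb{D})$.
   Context: Here $\overline{\mathbb{D}}$ is the closed unit disc (the support of Lebesgue measure restricted to $\mathbb{D}$), and the collection $E(\Lambda,\varphi)$ is indexed by $\Lambda$. *)

theory Defs
  imports "HOL-Analysis.Analysis"
begin

(* Elements of L^2(M) are represented by square-integrable functions; functions that agree
   almost everywhere are identified only through l2_inner and l2_norm. *)
definition L2_space :: "'a measure \<Rightarrow> ('a \<Rightarrow> complex) set" where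
  "L2_space M = {f \<in> borel_measurable M. integrable M (\<lambda>x. (norm (f x))\<^sup>2)}"

definition l2_inner :: "'a measure \<Rightarrow> ('a \<Rightarrow> complex) \<Rightarrow> ('a \<Rightarrow> complex) \<Rightarrow> complex" where
  "l2_inner M f g = (LINT x|M. f x * cnj (g x))"

definition l2_norm :: "'a measure \<Rightarrow> ('a \<Rightarrow> complex) \<Rightarrow> real" where
  "l2_norm M f = sqrt (LINT x|M. (norm (f x))\<^sup>2)"

(* The family e is indexed, so orthogonality is required for distinct indices, not merely for
   distinct functions. The last conjunct says that the closed linear span of the family is
   all of L^2(M). *)
definition orthogonal_basis_L2 :: "'a measure \<Rightarrow> 'i set \<Rightarrow> ('i \<Rightarrow> 'a \<Rightarrow> complex) \<Rightarrow> bool" where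
  "orthogonal_basis_L2 M I e \<longleftrightarrow>
     (\<forall>i\<in>I. e i \<in> L2_space M \<and> l2_norm M (e i) \<noteq> 0) \<and>
     (\<forall>i\<in>I. \<forall>j\<in>I. i \<noteq> j \<longrightarrow> l2_inner M (e i) (e j) = 0) \<and>
     (\<forall>f\<in>L2_space M. \<forall>\<epsilon>>0. \<exists>F c. finite F \<and> F \<subseteq> I \<and>
        l2_norm M (\<lambda>x. f x - (\<Sum>i\<in>F. c i * e i x)) < \<epsilon>)"

definition exp_system :: "('a \<Rightarrow> 'b::real_inner) \<Rightarrow> 'b \<Rightarrow> 'a \<Rightarrow> complex" where
  "exp_system \<phi> l x = exp (2 * complex_of_real pi * \<i> * complex_of_real (l \<bullet> \<phi> x))"

end

theory Submission
  imports Defs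
begin

text \<open>
  The disc is flattened to the unit square by a map \<open>(x, y) \<mapsto> (F x, G x y)\<close>, where \<open>F x\<close> is the
  fraction of the area of the disc to the left of the vertical line through \<open>x\<close> and \<open>G x y\<close> is the relative
  height of \<open>y\<close> on the chord cut out by that line. This map is a homeomorphism of the open disc onto the open unit
  square which multiplies areas by \<open>1 / pi\<close>, so the characters of the torus, which form
  an orthogonal basis over the square, pull back to an orthogonal basis over the disc. The frequencies
  are the integer lattice.

  Neither the inverse of the map nor the image of the measure has to be studied. Orthogonality amounts
  to the vanishing of the integral of each nonconstant exponential; by Fubini and the fundamental theorem of
  calculus it follows from \<open>F' = 2 * sqrt (1 - x\<^sup>2) / pi\<close> and from \<open>G\<close> being affine
  in \<open>y\<close> (\<open>integral_exp_system_disc\<close>).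

  Completeness holds much more generally (\<open>trig_poly_dense_L2\<close>): if a map from an open set \<open>S\<close> of finite
  measure to \<open>\<real>\<^sup>n\<close> becomes continuous and injective after reduction modulo \<open>\<int>\<^sup>n\<close>, then the span of
  the pulled back exponentials is dense in \<open>L\<^sup>2\<close> of \<open>S\<close>. On a compact subset of \<open>S\<close> the map is a
  homeomorphism onto a compact part of the torus, so a continuous function can be moved there, extended to
  the torus with the same bound, and approximated uniformly by Stone--Weierstrass.
\<close>

section \<open>Integer frequencies and their exponentials\<close>

definition int_lattice :: "(real ^ 'n) set" where
  "int_lattice = {l. \<forall>i. l $ i \<in> \<int>}"

lemma exp_system_cis: "exp_system \<phi> l x = cis (2 * pi * (l \<bullet> \<phi> x))"
  by (simp add: exp_system_def cis_conv_exp mult_ac)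

lemma norm_exp_system [simp]: "norm (exp_system \<phi> l x) = 1"
  by (simp add: exp_system_cis)

lemma exp_system_add: "exp_system \<phi> (l + m) x = exp_system \<phi> l x * exp_system \<phi> m x"
  by (simp add: exp_system_cis cis_mult inner_add_left algebra_simps)

lemma exp_system_diff: "exp_system \<phi> (l - m) x = exp_system \<phi> l x * cnj (exp_system \<phi> m x)"
  by (simp add: exp_system_cis cis_mult cis_cnj inner_diff_left algebra_simps)

lemma int_lattice_add: "l \<in> int_lattice \<Longrightarrow> m \<in> int_lattice \<Longrightarrow> l + m \<in> int_lattice"
  by (simp add: int_lattice_def)

lemma int_lattice_diff: "l \<in> int_lattice \<Longrightarrow> m \<in> int_lattice \<Longrightarrow> l - m \<in> int_lattice"
  by (simp add: int_lattice_def)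

lemma discrete_int_lattice: "discrete (int_lattice :: (real ^ 'n) set)"
proof (rule discreteI)
  fix l :: "real ^ 'n" assume l: "l \<in> int_lattice"
  have "m = l" if m: "m \<in> int_lattice" and d: "dist l m < 1" for m
  proof -
    have "m $ i = l $ i" for i
    proof -
      have "\<bar>(l - m) $ i\<bar> < 1"
        using component_le_norm_cart[of "l - m" i] d by (simp add: dist_norm)
      moreover have "(l - m) $ i \<in> \<int>" using int_lattice_diff[OF l m] by (simp add: int_lattice_def)
      ultimately have "(l - m) $ i = 0" by (metis Ints_nonzero_abs_less1)
      then show ?thesis by simp
    qed
    then show ?thesis by (simp add: vec_eq_iff)
  qed
  then show "l isolated_in int_lattice"
    using l unfolding isolated_in_dist_Ex_iff by (auto intro!: exI[of _ 1])
qed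

lemma countable_int_lattice: "countable (int_lattice :: (real ^ 'n) set)"
proof -
  have "countable (Basis \<rightarrow>\<^sub>E (\<int> :: real set) :: (real ^ 'n \<Rightarrow> real) set)"
    by (intro countable_PiE) (auto simp: Ints_def)
  then have "countable ((\<lambda>f. \<Sum>b\<in>Basis. f b *\<^sub>R b) ` (Basis \<rightarrow>\<^sub>E (\<int> :: real set) :: (real ^ 'n \<Rightarrow> real) set))"
    by (rule countable_image)
  moreover have "int_lattice \<subseteq> (\<lambda>f. \<Sum>b\<in>Basis. f b *\<^sub>R b) ` (Basis \<rightarrow>\<^sub>E (\<int> :: real set) :: (real ^ 'n \<Rightarrow> real) set)"
  proof
    fix l :: "real ^ 'n" assume "l \<in> int_lattice"
    then have "restrict (\<lambda>b. l \<bullet> b) Basis \<in> Basis \<rightarrow>\<^sub>E (\<int> :: real set)"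
      by (auto simp: int_lattice_def Basis_vec_def inner_axis)
    moreover have "l = (\<Sum>b\<in>Basis. restrict (\<lambda>b. l \<bullet> b) Basis b *\<^sub>R b)"
      by (simp add: euclidean_representation)
    ultimately show "l \<in> (\<lambda>f. \<Sum>b\<in>Basis. f b *\<^sub>R b) ` (Basis \<rightarrow>\<^sub>E (\<int> :: real set))"
      by (intro image_eqI[of _ _ "restrict (\<lambda>b. l \<bullet> b) Basis"])
  qed
  ultimately show ?thesis by (rule countable_subset[rotated])
qed

section \<open>Trigonometric polynomials\<close>

text \<open>The linear span of the exponentials with integer frequencies, generated one term at a
  time so that closure properties follow by induction instead of by rearranging finite sums.\<close>

inductive trig_poly :: "('a \<Rightarrow> real ^ 'n) \<Rightarrow> ('a \<Rightarrow> complex) \<Rightarrow> bool" for \<phi> where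
  zero: "trig_poly \<phi> (\<lambda>x. 0)"
| add_term: "trig_poly \<phi> f \<Longrightarrow> l \<in> int_lattice \<Longrightarrow> trig_poly \<phi> (\<lambda>x. f x + c * exp_system \<phi> l x)"

text \<open>The quotient map of \<open>\<real>\<^sup>n\<close> onto the torus \<open>\<real>\<^sup>n / \<int>\<^sup>n\<close>, realised inside \<open>\<complex>\<^sup>n\<close> so that
  polynomial approximation in a Euclidean space applies to functions on the torus.\<close>

definition torus :: "real ^ 'n \<Rightarrow> complex ^ 'n" where
  "torus v = (\<chi> i. cis (2 * pi * v $ i))"

lemma trig_poly_add:
  assumes "trig_poly \<phi> f" "trig_poly \<phi> g"
  shows "trig_poly \<phi> (\<lambda>x. f x + g x)"
  using assms(2)
proof induction
  case zero
  then show ?case using assms(1) by simp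
next
  case (add_term g l c)
  from trig_poly.add_term[OF add_term.IH add_term.hyps(2), of c] show ?case
    by (simp add: add.assoc)
qed

lemma trig_poly_term: "l \<in> int_lattice \<Longrightarrow> trig_poly \<phi> (\<lambda>x. c * exp_system \<phi> l x)"
  using trig_poly.add_term[OF trig_poly.zero, of l \<phi> c] by simp

lemma trig_poly_term_mult:
  assumes "trig_poly \<phi> f" "l \<in> int_lattice"
  shows "trig_poly \<phi> (\<lambda>x. c * exp_system \<phi> l x * f x)"
  using assms(1)
proof induction
  case zero
  then show ?case by (simp add: trig_poly.zero)
next
  case (add_term f m d)
  from trig_poly.add_term[OF add_term.IH int_lattice_add[OF assms(2) add_term.hyps(2)], of "c * d"]
  show ?case by (simp add: exp_system_add algebra_simps)
qed

lemma trig_poly_mult: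
  assumes "trig_poly \<phi> f" "trig_poly \<phi> g"
  shows "trig_poly \<phi> (\<lambda>x. f x * g x)"
  using assms(1)
proof induction
  case zero
  then show ?case by (simp add: trig_poly.zero)
next
  case (add_term f l c)
  from trig_poly_add[OF add_term.IH trig_poly_term_mult[OF assms(2) add_term.hyps(2), of c]]
  show ?case by (simp add: algebra_simps)
qed

lemma trig_poly_const: "trig_poly \<phi> (\<lambda>x. c)"
proof -
  have "0 \<in> int_lattice" by (simp add: int_lattice_def)
  from trig_poly_term[OF this, of \<phi> c] show ?thesis by (simp add: exp_system_def)
qed

lemma trig_poly_sum:
  "finite A \<Longrightarrow> (\<And>a. a \<in> A \<Longrightarrow> trig_poly \<phi> (f a)) \<Longrightarrow> trig_poly \<phi> (\<lambda>x. \<Sum>a\<in>A. f a x)"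
  by (induction A rule: finite_induct) (auto intro: trig_poly.zero trig_poly_add)

lemma trig_poly_eq_sum:
  assumes "trig_poly \<phi> f"
  shows "\<exists>F c. finite F \<and> F \<subseteq> int_lattice \<and> (\<forall>x. f x = (\<Sum>l\<in>F. c l * exp_system \<phi> l x))"
  using assms
proof induction
  case zero
  then show ?case by (intro exI[of _ "{}"]) auto
next
  case (add_term f l d)
  then obtain F c where F: "finite F" "F \<subseteq> int_lattice"
    and f: "\<And>x. f x = (\<Sum>l\<in>F. c l * exp_system \<phi> l x)" by auto
  define c' where "c' m = (if m \<in> F then c m else 0) + (if m = l then d else 0)" for m
  have "(\<Sum>m\<in>insert l F. c' m * exp_system \<phi> m x) = f x + d * exp_system \<phi> l x" for x
  proof -
    have "(\<Sum>m\<in>insert l F. c' m * exp_system \<phi> m x) =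
      (\<Sum>m\<in>insert l F. (if m \<in> F then c m * exp_system \<phi> m x else 0)) +
      (\<Sum>m\<in>insert l F. (if m = l then d * exp_system \<phi> m x else 0))"
      unfolding sum.distrib[symmetric] by (intro sum.cong) (auto simp: c'_def algebra_simps)
    also have "(\<Sum>m\<in>insert l F. (if m \<in> F then c m * exp_system \<phi> m x else 0)) = f x"
      unfolding f using F(1) by (intro sum.mono_neutral_cong_right) auto
    also have "(\<Sum>m\<in>insert l F. (if m = l then d * exp_system \<phi> m x else 0)) = d * exp_system \<phi> l x"
      using F(1) by simp
    finally show ?thesis .
  qed
  then show ?case using F add_term.hyps(2)
    by (intro exI[of _ "insert l F"] exI[of _ c']) auto
qed

text \<open>The real coordinates of a point of the torus are trigonometric polynomials of degree one,
  because each complex component \<open>z\<close> has modulus one and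
  conjugation on the unit circle is inversion: \<open>Re (cnj u * z) = (cnj u * z + u / z) / 2\<close>.\<close>

lemma trig_poly_torus_component: "trig_poly \<phi> (\<lambda>x. of_real (torus (\<phi> x) \<bullet> axis i u))"
proof -
  have L: "axis i 1 \<in> int_lattice" "- axis i 1 \<in> int_lattice"
    by (auto simp: int_lattice_def axis_def)
  have z: "complex_of_real (cis t \<bullet> u) = cnj u / 2 * cis t + u / 2 * cis (- t)" for t
    by (simp add: complex_eq_iff inner_complex_def field_simps)
  have "(\<lambda>x. complex_of_real (torus (\<phi> x) \<bullet> axis i u)) =
    (\<lambda>x. cnj u / 2 * exp_system \<phi> (axis i 1) x + u / 2 * exp_system \<phi> (- axis i 1) x)"
    by (simp add: inner_axis torus_def z exp_system_cis inner_axis')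
  then show ?thesis
    using trig_poly_add[OF trig_poly_term[OF L(1)] trig_poly_term[OF L(2)], of \<phi> "cnj u / 2" "u / 2"]
    by simp
qed

lemma trig_poly_real_polynomial:
  fixes \<phi> :: "'a \<Rightarrow> real ^ 'n" and p :: "complex ^ 'n \<Rightarrow> real"
  assumes "real_polynomial_function p"
  shows "trig_poly \<phi> (\<lambda>x. of_real (p (torus (\<phi> x))))"
  using assms
proof induction
  case (linear p)
  then interpret bounded_linear p .
  have *: "p z = (\<Sum>b\<in>Basis. (z \<bullet> b) * p b)" for z
  proof -
    have "p z = p (\<Sum>b\<in>Basis. (z \<bullet> b) *\<^sub>R b)" by (simp add: euclidean_representation)
    also have "\<dots> = (\<Sum>b\<in>Basis. (z \<bullet> b) * p b)" by (simp add: sum scaleR)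
    finally show ?thesis .
  qed
  have "trig_poly \<phi> (\<lambda>x. \<Sum>b\<in>Basis. of_real (torus (\<phi> x) \<bullet> b) * of_real (p b))"
    by (intro trig_poly_sum trig_poly_mult trig_poly_const finite_Basis)
      (auto simp: Basis_vec_def trig_poly_torus_component)
  moreover have "(\<lambda>x. complex_of_real (p (torus (\<phi> x)))) =
     (\<lambda>x. \<Sum>b\<in>Basis. of_real (torus (\<phi> x) \<bullet> b) * of_real (p b))"
  proof
    show "complex_of_real (p (torus (\<phi> x))) =
      (\<Sum>b\<in>Basis. of_real (torus (\<phi> x) \<bullet> b) * of_real (p b))" for x
      by (subst *) simp
  qed
  ultimately show ?case by simp
next
  case (const c)
  then show ?case by (rule trig_poly_const)
next
  case (add f g)
  then show ?case by (simp add: trig_poly_add)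
next
  case (mult f g)
  then show ?case by (simp add: trig_poly_mult)
qed

text \<open>This turns the approximation theorem for polynomials on \<open>\<complex>\<^sup>n\<close> into one for exponential sums.\<close>

lemma trig_poly_polynomial:
  fixes \<phi> :: "'a \<Rightarrow> real ^ 'n" and p :: "complex ^ 'n \<Rightarrow> complex"
  assumes "polynomial_function p"
  shows "trig_poly \<phi> (\<lambda>x. p (torus (\<phi> x)))"
proof -
  have "real_polynomial_function (\<lambda>z. Re (p z))" "real_polynomial_function (\<lambda>z. Im (p z))"
    using assms bounded_linear_Re bounded_linear_Im
    by (auto simp: polynomial_function_def o_def)
  then have "trig_poly \<phi> (\<lambda>x. of_real (Re (p (torus (\<phi> x)))) + \<i> * of_real (Im (p (torus (\<phi> x)))))"
    by (intro trig_poly_add trig_poly_mult trig_poly_const trig_poly_real_polynomial)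
  then show ?thesis by (simp flip: complex_eq)
qed

section \<open>Density of trigonometric polynomials under a torus-valued embedding\<close>

text \<open>A Lebesgue measurable function is an almost everywhere limit of continuous functions;
  composing these with the nearest-point retraction onto a disc keeps them uniformly bounded and,
  as the retraction is continuous and fixes the values of \<open>f\<close>, does not change the limit.\<close>

lemma ae_limit_bounded_continuous:
  fixes f :: "'a::euclidean_space \<Rightarrow> complex"
  assumes f: "f \<in> borel_measurable (lebesgue_on S)" and S: "S \<in> sets lebesgue"
    and B: "\<And>x. x \<in> S \<Longrightarrow> norm (f x) \<le> B" "0 \<le> B"
  shows "\<exists>g :: nat \<Rightarrow> 'a \<Rightarrow> complex. (\<forall>n. continuous_on UNIV (g n)) \<and> (\<forall>n x. norm (g n x) \<le> B) \<and>
    (AE x in lebesgue_on S. (\<lambda>n. g n x) \<longlonglongrightarrow> f x)"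
proof -
  have "(\<lambda>x. if x \<in> S then f x else 0) \<in> borel_measurable lebesgue"
    using f S by (rule borel_measurable_if_I)
  then have "(\<lambda>x. if x \<in> S then f x else 0) measurable_on UNIV"
    by (rule lebesgue_measurable_imp_measurable_on) auto
  then have "f measurable_on S" by (simp add: measurable_on_UNIV)
  then obtain N h where N: "negligible N" and h: "\<And>n. continuous_on UNIV (h n :: 'a \<Rightarrow> complex)"
    and lim: "\<And>x. x \<notin> N \<Longrightarrow> (\<lambda>n. h n x) \<longlonglongrightarrow> (if x \<in> S then f x else 0)"
    unfolding measurable_on_def by blast
  define r where "r = (closest_point (cball 0 B) :: complex \<Rightarrow> complex)"
  have ne: "closed (cball (0::complex) B)" "convex (cball (0::complex) B)" "cball (0::complex) B \<noteq> {}"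
    using B(2) by auto
  have r: "continuous_on UNIV r" "\<And>z. norm (r z) \<le> B" "\<And>z. norm z \<le> B \<Longrightarrow> r z = z"
    unfolding r_def using ne closest_point_in_set[OF ne(1) ne(3)]
    by (auto intro: continuous_on_closest_point closest_point_self)
  show ?thesis
  proof (intro exI[of _ "\<lambda>n x. r (h n x)"] conjI allI)
    show "continuous_on UNIV (\<lambda>x. r (h n x))" for n
      using continuous_on_compose2[OF r(1) h] by auto
    show "norm (r (h n x)) \<le> B" for n x by (rule r)
    have *: "(\<lambda>n. r (h n x)) \<longlonglongrightarrow> f x" if "x \<in> S" "x \<notin> N" for x
    proof -
      have "isCont r (f x)" using r(1) by (simp add: continuous_on_eq_continuous_at)
      then have "(\<lambda>n. r (h n x)) \<longlonglongrightarrow> r (f x)"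
        using lim[OF that(2)] that(1) by (intro isCont_tendsto_compose[of _ r]) auto
      then show ?thesis using r(3) B(1) that(1) by simp
    qed
    have "AE x in lebesgue. x \<notin> N"
      using N by (simp add: negligible_iff_null_sets AE_not_in)
    then have "AE x in lebesgue. x \<in> S \<longrightarrow> (\<lambda>n. r (h n x)) \<longlonglongrightarrow> f x"
      by eventually_elim (use * in blast)
    then show "AE x in lebesgue_on S. (\<lambda>n. r (h n x)) \<longlonglongrightarrow> f x"
      using S by (subst AE_restrict_space_iff) auto
  qed
qed

text \<open>On a compact set a continuous injection is a homeomorphism onto its image, so \<open>g\<close> can be
  carried over to a compact part of the torus. Tietze extends it from there with the same bound, and
  Stone--Weierstrass approximates the extension. The bound on the whole torus is what matters
  later: outside \<open>K\<close> nothing is approximated, but there the error stays bounded.\<close>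

lemma trig_poly_approx_on_compact:
  fixes \<phi> :: "'a::t2_space \<Rightarrow> real ^ 'n" and g :: "'a \<Rightarrow> complex"
  assumes K: "compact K" and cont: "continuous_on K (\<lambda>x. torus (\<phi> x))"
    and inj: "inj_on (\<lambda>x. torus (\<phi> x)) K"
    and g: "continuous_on K g" "\<And>x. x \<in> K \<Longrightarrow> norm (g x) \<le> B" and B: "0 \<le> B" and e: "0 < e"
  shows "\<exists>p :: complex ^ 'n \<Rightarrow> complex. polynomial_function p \<and>
    (\<forall>x\<in>K. norm (g x - p (torus (\<phi> x))) < e) \<and> (\<forall>x. norm (p (torus (\<phi> x))) < B + e)"
proof -
  define q where "q = (\<lambda>x. torus (\<phi> x))"
  define k where "k = inv_into K q"
  have k: "k (q x) = x" if "x \<in> K" for x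
    using inv_into_f_f[OF inj that] by (simp add: k_def q_def)
  have "continuous_on (q ` K) k"
    using cont K k by (intro continuous_on_inv) (auto simp: q_def)
  then have gk: "continuous_on (q ` K) (\<lambda>z. g (k z))"
    by (rule continuous_on_compose2[OF g(1)]) (auto simp: k)
  have "compact (q ` K)" using cont K by (intro compact_continuous_image) (auto simp: q_def)
  then have cl: "closedin (top_of_set UNIV) (q ` K)" by (simp add: compact_imp_closed)
  obtain G where G: "continuous_on UNIV G" "\<And>z. z \<in> q ` K \<Longrightarrow> G z = g (k z)" "\<And>z. norm (G z) \<le> B"
    by (rule Tietze[OF gk cl B]) (auto simp: k g(2))
  have bd: "torus v \<in> cball 0 (real CARD('n))" for v :: "real ^ 'n"
  proof -
    have "norm (torus v) \<le> (\<Sum>i\<in>UNIV. norm (torus v $ i))"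
      unfolding norm_vec_def by (rule L2_set_le_sum) auto
    then show ?thesis by (simp add: torus_def)
  qed
  obtain p where p: "polynomial_function p" "\<And>z. z \<in> cball 0 (real CARD('n)) \<Longrightarrow> norm (G z - p z) < e"
    using Stone_Weierstrass_polynomial_function[OF compact_cball[of 0 "real CARD('n)"]
        continuous_on_subset[OF G(1) subset_UNIV] e] by metis
  show ?thesis
  proof (intro exI[of _ p] conjI ballI allI)
    show "polynomial_function p" by fact
    show "norm (g x - p (torus (\<phi> x))) < e" if "x \<in> K" for x
      using p(2)[OF bd, of "\<phi> x"] G(2)[of "q x"] k[OF that] that by (simp add: q_def)
    show "norm (p (torus (\<phi> x))) < B + e" for x
      using p(2)[OF bd, of "\<phi> x"] G(3)[of "torus (\<phi> x)"]
        norm_triangle_ineq2[of "p (torus (\<phi> x))" "G (torus (\<phi> x))"]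
      by (simp add: norm_minus_commute)
  qed
qed

text \<open>Exhaust \<open>S\<close> by compact sets \<open>C n\<close> and approximate the \<open>n\<close>-th member of a sequence of
  continuous functions tending to \<open>f\<close> on \<open>C n\<close>, with error \<open>1 / (n + 1)\<close>. Each point
  of \<open>S\<close> eventually lies in all the \<open>C n\<close>, so these exponential sums converge to \<open>f\<close> almost
  everywhere. They are uniformly bounded and \<open>S\<close> has finite measure, so dominated convergence gives
  convergence in \<open>L\<^sup>2\<close>.\<close>

lemma trig_poly_dense_bounded:
  fixes \<phi> :: "'a::euclidean_space \<Rightarrow> real ^ 'n" and f :: "'a \<Rightarrow> complex"
  assumes S: "open S" "S \<in> lmeasurable" and cont: "continuous_on S (\<lambda>x. torus (\<phi> x))"
    and inj: "inj_on (\<lambda>x. torus (\<phi> x)) S"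
    and f: "f \<in> borel_measurable (lebesgue_on S)"
    and B: "\<And>x. x \<in> S \<Longrightarrow> norm (f x) \<le> B" "0 \<le> B" and e: "0 < e"
  obtains P where "trig_poly \<phi> P" "P \<in> borel_measurable (lebesgue_on S)"
    "integrable (lebesgue_on S) (\<lambda>x. (norm (f x - P x))\<^sup>2)"
    "(LINT x|lebesgue_on S. (norm (f x - P x))\<^sup>2) < e"
proof -
  have Sm: "S \<in> sets lebesgue" using S(2) by (simp add: fmeasurableD)
  from ae_limit_bounded_continuous[OF f Sm B] obtain g :: "nat \<Rightarrow> 'a \<Rightarrow> complex"
    where g': "(\<forall>n. continuous_on UNIV (g n)) \<and> (\<forall>n x. norm (g n x) \<le> B) \<and>
      (AE x in lebesgue_on S. (\<lambda>n. g n x) \<longlonglongrightarrow> f x)" ..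
  then have g: "\<And>n. continuous_on UNIV (g n)" "\<And>n x. norm (g n x) \<le> B"
    and lim: "AE x in lebesgue_on S. (\<lambda>n. g n x) \<longlonglongrightarrow> f x" by simp_all
  obtain C where C: "\<And>n. compact (C n)" "\<And>n. C n \<subseteq> S"
    "\<And>n. C n \<subseteq> interior (C (Suc n))" "\<Union> (range C) = S"
    "\<And>K. compact K \<Longrightarrow> K \<subseteq> S \<Longrightarrow> \<exists>N. \<forall>n\<ge>N. K \<subseteq> (C n)"
    by (rule open_Union_compact_subsets[OF S(1)]) (rule that)
  have "\<exists>p. polynomial_function p \<and> (\<forall>x\<in>C n. norm (g n x - p (torus (\<phi> x))) < inverse (Suc n)) \<and>
    (\<forall>x. norm (p (torus (\<phi> x))) < B + inverse (Suc n))" for n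
  proof (rule trig_poly_approx_on_compact[of "C n" \<phi> "g n" B "inverse (Suc n)"])
    show "continuous_on (C n) (\<lambda>x. torus (\<phi> x))" "inj_on (\<lambda>x. torus (\<phi> x)) (C n)" "continuous_on (C n) (g n)"
      using C(2) by (auto intro: continuous_on_subset[OF cont] inj_on_subset[OF inj] continuous_on_subset[OF g(1)])
  qed (use C(1) g B(2) in auto)
  then have "\<exists>p. \<forall>n. polynomial_function (p n) \<and> (\<forall>x\<in>C n. norm (g n x - p n (torus (\<phi> x))) < inverse (Suc n)) \<and>
    (\<forall>x. norm (p n (torus (\<phi> x))) < B + inverse (Suc n))"
    by (intro choice allI)
  then obtain p where p: "\<And>n. polynomial_function (p n)"
    "\<And>n x. x \<in> C n \<Longrightarrow> norm (g n x - p n (torus (\<phi> x))) < inverse (Suc n)"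
    "\<And>n x. norm (p n (torus (\<phi> x))) < B + inverse (Suc n)" by auto
  define P where "P n x = p n (torus (\<phi> x))" for n x
  have Pm: "P n \<in> borel_measurable (lebesgue_on S)" for n
    unfolding P_def
    by (intro continuous_imp_measurable_on_sets_lebesgue Sm
        continuous_on_compose2[OF continuous_on_polymonial_function[OF p(1)] cont]) auto
  have Pb: "norm (P n x) \<le> B + 1" for n x
  proof -
    have "inverse (real (Suc n)) \<le> 1" by (simp add: field_simps)
    then show ?thesis using p(3)[of n x] by (simp add: P_def)
  qed
  have Plim: "AE x in lebesgue_on S. (\<lambda>n. P n x) \<longlonglongrightarrow> f x"
    using lim AE_space
  proof eventually_elim
    case (elim x)
    then have x: "x \<in> S" by simp
    obtain N where N: "\<And>n. n \<ge> N \<Longrightarrow> x \<in> C n" using C(5)[of "{x}"] x by auto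
    have "(\<lambda>n. g n x - P n x) \<longlonglongrightarrow> 0"
    proof (rule Lim_null_comparison)
      show "\<forall>\<^sub>F n in sequentially. norm (g n x - P n x) \<le> inverse (real (Suc n))"
        unfolding P_def using eventually_ge_at_top[of N]
        by eventually_elim (rule less_imp_le[OF p(2)[OF N]])
    qed (rule LIMSEQ_inverse_real_of_nat)
    from tendsto_diff[OF elim(1) this] show ?case by simp
  qed
  have bound: "(norm (f x - P n x))\<^sup>2 \<le> (2 * B + 1)\<^sup>2" if "x \<in> S" for n x
  proof (rule power_mono)
    show "norm (f x - P n x) \<le> 2 * B + 1"
      using norm_triangle_ineq4[of "f x" "P n x"] B(1)[OF that] Pb[of n x] by simp
  qed auto
  have fin: "finite_measure (lebesgue_on S)" using S(2) by (rule finite_measure_lebesgue_on)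
  then interpret finite_measure "lebesgue_on S" .
  have meas: "(\<lambda>x. (norm (f x - P n x))\<^sup>2) \<in> borel_measurable (lebesgue_on S)" for n
    using f Pm[of n] by measurable
  have int: "integrable (lebesgue_on S) (\<lambda>x. (norm (f x - P n x))\<^sup>2)" for n
    by (rule integrable_const_bound[of _ "(2 * B + 1)\<^sup>2", OF AE_I2 meas]) (use bound in auto)
  have "(\<lambda>n. LINT x|lebesgue_on S. (norm (f x - P n x))\<^sup>2) \<longlonglongrightarrow> (LINT x|lebesgue_on S. 0)"
  proof (rule integral_dominated_convergence[where w = "\<lambda>_. (2 * B + 1)\<^sup>2"])
    show "AE x in lebesgue_on S. (\<lambda>n. (norm (f x - P n x))\<^sup>2) \<longlonglongrightarrow> 0"
      using Plim
    proof eventually_elim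
      case (elim x)
      then have "(\<lambda>n. (norm (f x - P n x))\<^sup>2) \<longlonglongrightarrow> (norm (f x - f x))\<^sup>2"
        by (intro tendsto_intros)
      then show ?case by simp
    qed
    show "AE x in lebesgue_on S. norm ((norm (f x - P n x))\<^sup>2) \<le> (2 * B + 1)\<^sup>2" for n
      by (rule AE_I2) (use bound in auto)
  qed (use meas in auto)
  then have "\<forall>\<^sub>F n in sequentially. (LINT x|lebesgue_on S. (norm (f x - P n x))\<^sup>2) < e"
    using e by (auto intro: order_tendstoD)
  then obtain n where n: "(LINT x|lebesgue_on S. (norm (f x - P n x))\<^sup>2) < e"
    by (auto simp: eventually_sequentially)
  show ?thesis
  proof
    show "trig_poly \<phi> (P n)" unfolding P_def by (intro trig_poly_polynomial p(1))
  qed (fact Pm int n)+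
qed

lemma L2_truncation:
  fixes f :: "'a \<Rightarrow> complex"
  assumes f: "f \<in> borel_measurable M" and i: "integrable M (\<lambda>x. (norm (f x))\<^sup>2)"
  shows "(\<lambda>n. LINT x|M. (norm (f x - (if norm (f x) \<le> real n then f x else 0)))\<^sup>2) \<longlonglongrightarrow> 0"
proof -
  have "(\<lambda>n. LINT x|M. (norm (f x - (if norm (f x) \<le> real n then f x else 0)))\<^sup>2) \<longlonglongrightarrow> (LINT x|M. 0)"
  proof (rule integral_dominated_convergence[where w = "\<lambda>x. (norm (f x))\<^sup>2"])
    show "AE x in M. (\<lambda>n. (norm (f x - (if norm (f x) \<le> real n then f x else 0)))\<^sup>2) \<longlonglongrightarrow> 0"
    proof (rule AE_I2, rule tendsto_eventually)
      fix x
      obtain N where "norm (f x) \<le> real N" using real_arch_simple by blast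
      then show "\<forall>\<^sub>F n in sequentially. (norm (f x - (if norm (f x) \<le> real n then f x else 0)))\<^sup>2 = 0"
        by (intro eventually_sequentiallyI[of N]) auto
    qed
  qed (use f i in auto)
  then show ?thesis by simp
qed

text \<open>The reduction to bounded functions is by truncation; \<open>\<bar>a + b\<bar>\<^sup>2 \<le> 2 \<bar>a\<bar>\<^sup>2 + 2 \<bar>b\<bar>\<^sup>2\<close> takes the
  place of the triangle inequality of \<open>L\<^sup>2\<close> and accounts for the factor 4 in the choice of \<open>d\<close>.\<close>

lemma trig_poly_dense_L2:
  fixes \<phi> :: "'a::euclidean_space \<Rightarrow> real ^ 'n" and f :: "'a \<Rightarrow> complex"
  assumes S: "open S" "S \<in> lmeasurable" and cont: "continuous_on S (\<lambda>x. torus (\<phi> x))"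
    and inj: "inj_on (\<lambda>x. torus (\<phi> x)) S"
    and f: "f \<in> L2_space (lebesgue_on S)" and e: "0 < e"
  obtains P where "trig_poly \<phi> P" "l2_norm (lebesgue_on S) (\<lambda>x. f x - P x) < e"
proof -
  let ?M = "lebesgue_on S"
  from f have fm: "f \<in> borel_measurable ?M" and fi: "integrable ?M (\<lambda>x. (norm (f x))\<^sup>2)"
    by (auto simp: L2_space_def)
  define d where "d = e\<^sup>2 / 4"
  have d: "d > 0" using e by (simp add: d_def)
  from order_tendstoD(2)[OF L2_truncation[OF fm fi] d]
  obtain n where n: "(LINT x|?M. (norm (f x - (if norm (f x) \<le> real n then f x else 0)))\<^sup>2) < d"
    by (auto simp: eventually_sequentially)
  define h where "h x = (if norm (f x) \<le> real n then f x else 0)" for x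
  have hm: "h \<in> borel_measurable ?M" unfolding h_def using fm by measurable
  obtain P where P: "trig_poly \<phi> P" "P \<in> borel_measurable ?M"
    "integrable ?M (\<lambda>x. (norm (h x - P x))\<^sup>2)" "(LINT x|?M. (norm (h x - P x))\<^sup>2) < d"
    by (rule trig_poly_dense_bounded[OF S cont inj hm _ _ d, of "real n"]) (auto simp: h_def)
  have fh: "integrable ?M (\<lambda>x. (norm (f x - h x))\<^sup>2)"
    by (rule Bochner_Integration.integrable_bound[OF fi]) (use fm hm in \<open>auto simp: h_def\<close>)
  have le: "(norm (f x - P x))\<^sup>2 \<le> 2 * (norm (f x - h x))\<^sup>2 + 2 * (norm (h x - P x))\<^sup>2" for x
  proof -
    have "(norm (f x - P x))\<^sup>2 \<le> (norm (f x - h x) + norm (h x - P x))\<^sup>2"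
      using norm_triangle_ineq[of "f x - h x" "h x - P x"] by (intro power_mono) auto
    also have "\<dots> \<le> 2 * (norm (f x - h x))\<^sup>2 + 2 * (norm (h x - P x))\<^sup>2"
      using sum_squares_bound[of "norm (f x - h x)" "norm (h x - P x)"] by (simp add: power2_sum)
    finally show ?thesis .
  qed
  have ri: "integrable ?M (\<lambda>x. 2 * (norm (f x - h x))\<^sup>2 + 2 * (norm (h x - P x))\<^sup>2)"
    using fh P(3) by simp
  have "integrable ?M (\<lambda>x. (norm (f x - P x))\<^sup>2)"
    by (rule Bochner_Integration.integrable_bound[OF ri]) (use fm P(2) le in auto)
  then have "(LINT x|?M. (norm (f x - P x))\<^sup>2) \<le>
    (LINT x|?M. 2 * (norm (f x - h x))\<^sup>2 + 2 * (norm (h x - P x))\<^sup>2)"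
    using ri le by (intro integral_mono) auto
  also have "\<dots> = 2 * (LINT x|?M. (norm (f x - h x))\<^sup>2) + 2 * (LINT x|?M. (norm (h x - P x))\<^sup>2)"
    using fh P(3) by simp
  also have "\<dots> < e\<^sup>2"
    using n P(4) by (simp add: d_def h_def)
  finally have "l2_norm ?M (\<lambda>x. f x - P x) < e"
    unfolding l2_norm_def using e by (simp add: real_less_lsqrt)
  with P(1) show ?thesis by (rule that)
qed

section \<open>Integration over the disc\<close>

lemma vector_2_eq: "(vector [x, y] :: real ^ 2) = x *\<^sub>R axis 1 1 + y *\<^sub>R axis 2 1"
  by (simp add: vec_eq_iff forall_2 axis_def)

lemma measurable_vector_2: "(\<lambda>(x, y). vector [x, y] :: real ^ 2) \<in> borel_measurable lborel"
  unfolding case_prod_beta' vector_2_eq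
  by (intro borel_measurable_add borel_measurable_scaleR borel_measurable_const) 
    (auto intro!: borel_measurable_continuous_onI continuous_intros)

text \<open>Fubini's theorem is about product measures, whereas the disc lives in \<open>real ^ 2\<close>; this is the
  bridge between the two planes.\<close>

lemma lborel_vec2: "(lborel :: (real ^ 2) measure) = distr lborel borel (\<lambda>(x, y). vector [x, y])"
proof (rule lborel_eqI)
  fix l u :: "real ^ 2" assume le: "\<And>b. b \<in> Basis \<Longrightarrow> l \<bullet> b \<le> u \<bullet> b"
  have le': "l $ i \<le> u $ i" for i
    using le[of "axis i 1"] by (simp add: inner_axis)
  have "(\<lambda>(x, y). vector [x, y] :: real ^ 2) -` box l u \<inter> space lborel = box (l $ 1, l $ 2) (u $ 1, u $ 2)"
  proof (intro set_eqI, clarsimp)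
    fix x y
    have "(x, y) \<in> box (l $ 1, l $ 2) (u $ 1, u $ 2) \<longleftrightarrow> l $ 1 < x \<and> x < u $ 1 \<and> l $ 2 < y \<and> y < u $ 2"
      by (auto simp: mem_box Basis_prod_def)
    then show "(vector [x, y] :: real ^ 2) \<in> box l u \<longleftrightarrow> (x, y) \<in> box (l $ 1, l $ 2) (u $ 1, u $ 2)"
      by (auto simp: mem_box_cart forall_2)
  qed
  then have "emeasure (distr lborel borel (\<lambda>(x, y). vector [x, y])) (box l u) =
      emeasure lborel (box (l $ 1, l $ 2) (u $ 1, u $ 2))"
    by (simp add: emeasure_distr[OF measurable_vector_2])
  also have "\<dots> = ennreal (\<Prod>b\<in>Basis. ((u $ 1, u $ 2) - (l $ 1, l $ 2)) \<bullet> b)"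
    by (rule emeasure_lborel_box) (use le' in \<open>auto simp: Basis_prod_def\<close>)
  also have "(\<Prod>b\<in>Basis. ((u $ 1, u $ 2) - (l $ 1, l $ 2)) \<bullet> b) = (u $ 1 - l $ 1) * (u $ 2 - l $ 2)"
    by (simp add: Basis_prod_def)
  also have "(u $ 1 - l $ 1) * (u $ 2 - l $ 2) = (\<Prod>b\<in>Basis. (u - l) \<bullet> b)"
  proof -
    have B: "(Basis :: (real ^ 2) set) = {axis 1 1, axis 2 1}"
      by (auto simp: Basis_vec_def UNIV_2)
    have "axis 1 1 \<noteq> (axis 2 1 :: real ^ 2)" by (simp add: axis_eq_axis)
    then show ?thesis unfolding B by (simp add: inner_axis)
  qed
  finally show "emeasure (distr lborel borel (\<lambda>(x, y). vector [x, y])) (box l u) = (\<Prod>b\<in>Basis. (u - l) \<bullet> b)" .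
qed simp

lemma disc_iff: "(vector [x, y] :: real ^ 2) \<in> ball 0 1 \<longleftrightarrow> x\<^sup>2 + y\<^sup>2 < 1"
  by (simp add: norm_vec_def L2_set_def UNIV_2)

lemma abs_less_sqrt: "x\<^sup>2 + y\<^sup>2 < 1 \<longleftrightarrow> \<bar>y\<bar> < sqrt (1 - x\<^sup>2)" for x y :: real
proof -
  have "\<bar>y\<bar> < sqrt (1 - x\<^sup>2) \<longleftrightarrow> sqrt (y\<^sup>2) < sqrt (1 - x\<^sup>2)" by simp
  also have "\<dots> \<longleftrightarrow> y\<^sup>2 < 1 - x\<^sup>2" by (rule real_sqrt_less_iff)
  finally show ?thesis by auto
qed

lemma integral_disc_iterated:
  fixes f :: "real ^ 2 \<Rightarrow> complex"
  assumes cont: "continuous_on (ball 0 1) f" and bd: "\<And>x. x \<in> ball 0 1 \<Longrightarrow> norm (f x) \<le> B"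
  shows "(LINT v|lebesgue_on (ball 0 1). f v) =
    (LINT x|lborel. LINT y|lborel. indicator {y. x\<^sup>2 + y\<^sup>2 < 1} y *\<^sub>R f (vector [x, y]))"
proof -
  define g where "g v = indicator (ball 0 1) v *\<^sub>R f v" for v
  have gm: "g \<in> borel_measurable borel"
    unfolding g_def using borel_measurable_continuous_on_indicator[OF _ cont] by simp
  have "set_integrable lborel (ball (0::real^2) 1) (\<lambda>_. B)" 
    unfolding set_integrable_def
    by (intro integrable_scaleR_left integrable_real_indicator)
      (use emeasure_bounded_finite[OF bounded_ball[of "0::real^2" 1]] in auto)
  then have gi: "integrable lborel g"
    unfolding set_integrable_def
    by (rule Bochner_Integration.integrable_bound)
      (use gm bd in \<open>auto simp: g_def indicator_def intro: order_trans[OF _ abs_ge_self]\<close>)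
  have "(LINT v|lebesgue_on (ball 0 1). f v) = (LINT v|lebesgue. g v)"
    unfolding g_def[abs_def] by (rule integral_restrict_space) simp
  also have "\<dots> = (LINT v|lborel. g v)" using gm by (intro integral_completion) simp
  also have "\<dots> = (LINT p|lborel. g (case p of (x, y) \<Rightarrow> vector [x, y]))"
    by (subst lborel_vec2, subst integral_distr[OF measurable_vector_2 gm]) simp
  also have "\<dots> = (LINT p|(lborel \<Otimes>\<^sub>M lborel). g (case p of (x, y) \<Rightarrow> vector [x, y]))"
    by (simp add: lborel_prod)
  also have "\<dots> = (LINT x|lborel. LINT y|lborel. g (vector [x, y]))"
  proof -
    have "integrable (distr lborel borel (\<lambda>(x, y). vector [x, y])) g"
      using gi by (simp flip: lborel_vec2)
    then have "integrable lborel (\<lambda>p. g (case p of (x, y) \<Rightarrow> vector [x, y]))"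
      by (subst (asm) integrable_distr_eq[OF measurable_vector_2 gm])
    then have "integrable (lborel \<Otimes>\<^sub>M lborel) (\<lambda>p. g (case p of (x, y) \<Rightarrow> vector [x, y]))"
      by (simp add: lborel_prod)
    from lborel_pair.integral_fst'[OF this] show ?thesis by simp
  qed
  also have "(\<lambda>x. LINT y|lborel. g (vector [x, y])) =
      (\<lambda>x. LINT y|lborel. indicator {y. x\<^sup>2 + y\<^sup>2 < 1} y *\<^sub>R f (vector [x, y]))"
    by (intro ext Bochner_Integration.integral_cong refl) (simp only: g_def indicator_def disc_iff mem_Collect_eq)
  finally show ?thesis .
qed

text \<open>Differentiability is asked for in the interior only, since arcsine, which
  occurs in the area function below, is not differentiable at the ends of its domain.\<close>

lemma integral_lborel_open_interval_FTC:
  fixes F f :: "real \<Rightarrow> complex"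
  assumes ab: "a \<le> b" and F: "continuous_on {a..b} F" and f: "continuous_on {a..b} f"
    and der: "\<And>x. x \<in> {a<..<b} \<Longrightarrow> (F has_vector_derivative f x) (at x)"
  shows "(LINT x|lborel. indicator {a<..<b} x *\<^sub>R f x) = F b - F a"
proof -
  have i: "set_integrable lborel {a..b} f" using f by (rule borel_integrable_atLeastAtMost')
  have "AE x in lborel. x \<noteq> a \<and> x \<noteq> b"
    using AE_lborel_singleton[of a] AE_lborel_singleton[of b] by eventually_elim simp
  then have "AE x in lborel. indicator {a<..<b} x *\<^sub>R f x = indicator {a..b} x *\<^sub>R f x"
    by eventually_elim (auto simp: indicator_def)
  moreover have "set_integrable lborel {a<..<b} f" 
    by (rule set_integrable_subset[OF i]) auto
  ultimately have "(LINT x|lborel. indicator {a<..<b} x *\<^sub>R f x) = (LINT x:{a..b}|lborel. f x)"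
    using i unfolding set_lebesgue_integral_def set_integrable_def by (intro integral_cong_AE) auto
  also have "\<dots> = integral {a..b} f" by (rule set_borel_integral_eq_integral(2)[OF i])
  also have "\<dots> = F b - F a"
    by (intro integral_unique fundamental_theorem_of_calculus_interior ab F der)
  finally show ?thesis .
qed

section \<open>The map from the disc to the square\<close>

definition half_chord :: "real \<Rightarrow> real" where
  "half_chord x = sqrt (1 - x\<^sup>2)"

text \<open>The fraction of the area of the unit disc that lies to the left of the vertical line
  through \<open>x\<close>, written in closed form as an antiderivative of \<open>2 * half_chord x / pi\<close>.\<close>

definition area_fraction :: "real \<Rightarrow> real" where
  "area_fraction x = (x * half_chord x + arcsin x) / pi + 1 / 2"

text \<open>The position of \<open>y\<close> on the vertical chord through \<open>x\<close>, measured from its lower end as a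
  fraction of the length of the chord. On the boundary of the disc the chord may have length zero, and then
  \<open>y / 0 = 0\<close> supplies a value.\<close>

definition chord_fraction :: "real \<Rightarrow> real \<Rightarrow> real" where
  "chord_fraction x y = (y / half_chord x + 1) / 2"

definition disc_to_square :: "real ^ 2 \<Rightarrow> real ^ 2" where
  "disc_to_square v = vector [area_fraction (v $ 1), chord_fraction (v $ 1) (v $ 2)]"

lemma half_chord_pos: "\<bar>x\<bar> < 1 \<Longrightarrow> half_chord x > 0"
  by (simp add: half_chord_def abs_square_less_1)

lemma area_fraction_deriv:
  assumes "\<bar>x\<bar> < 1"
  shows "(area_fraction has_real_derivative 2 * half_chord x / pi) (at x)"
proof -
  have s: "half_chord x > 0" "(half_chord x)\<^sup>2 = 1 - x\<^sup>2" "1 - x\<^sup>2 > 0"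
    using half_chord_pos[OF assms] assms by (auto simp: half_chord_def abs_square_less_1 less_imp_le)
  have "((\<lambda>x. (x * sqrt (1 - x\<^sup>2) + arcsin x) / pi + 1 / 2) has_real_derivative
     (sqrt (1 - x\<^sup>2) + x * (- x * inverse (sqrt (1 - x\<^sup>2))) + inverse (sqrt (1 - x\<^sup>2))) / pi) (at x)"
    using assms s(3)
    by (auto intro!: derivative_eq_intros DERIV_arcsin simp: abs_less_iff field_simps)
  moreover have "half_chord x + x * (- x * inverse (half_chord x)) + inverse (half_chord x) = 2 * half_chord x"
    using s by (simp add: field_simps power2_eq_square)
  ultimately show ?thesis by (simp only: half_chord_def area_fraction_def[abs_def])
qed

lemma continuous_half_chord: "continuous_on A half_chord"
  unfolding half_chord_def by (intro continuous_intros)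

lemma continuous_area_fraction: "continuous_on {-1..1} area_fraction"
  unfolding area_fraction_def by (intro continuous_intros continuous_half_chord) auto

lemma area_fraction_ends: "area_fraction (-1) = 0" "area_fraction 1 = 1"
  by (simp_all add: area_fraction_def half_chord_def)

lemma area_fraction_strict_mono: 
  assumes "-1 \<le> x" "x < y" "y \<le> 1" shows "area_fraction x < area_fraction y"
proof (rule DERIV_pos_imp_increasing_open[OF assms(2)])
  fix t assume t: "x < t" "t < y"
  with assms have "\<bar>t\<bar> < 1" by auto
  then show "\<exists>d. DERIV area_fraction t :> d \<and> d > 0"
    using area_fraction_deriv half_chord_pos by fastforce
qed (rule continuous_on_subset[OF continuous_area_fraction], use assms in auto)

lemma area_fraction_bounds: "\<bar>x\<bar> < 1 \<Longrightarrow> 0 < area_fraction x \<and> area_fraction x < 1"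
  using area_fraction_strict_mono[of "-1" x] area_fraction_strict_mono[of x 1] area_fraction_ends by auto

lemma chord_fraction_bounds: "\<bar>y\<bar> < half_chord x \<Longrightarrow> 0 < chord_fraction x y \<and> chord_fraction x y < 1"
  by (auto simp: chord_fraction_def abs_less_iff field_simps)

lemma disc_coords:
  fixes v :: "real ^ 2"
  assumes "v \<in> ball 0 1" shows "\<bar>v $ 1\<bar> < 1" "\<bar>v $ 2\<bar> < half_chord (v $ 1)"
proof -
  have "norm (v $ 1) \<le> norm v" by (rule Finite_Cartesian_Product.norm_nth_le)
  then show "\<bar>v $ 1\<bar> < 1" using assms by simp
  have "(v $ 1)\<^sup>2 + (v $ 2)\<^sup>2 < 1" using assms by (simp add: norm_vec_def L2_set_def UNIV_2)
  then show "\<bar>v $ 2\<bar> < half_chord (v $ 1)" by (simp add: abs_less_sqrt half_chord_def)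
qed

lemma continuous_disc_to_square: "continuous_on (ball 0 1) disc_to_square"
proof -
  have "continuous_on (ball 0 1) (\<lambda>v::real^2. area_fraction (v $ 1))"
    by (rule continuous_on_compose2[OF continuous_area_fraction])
      (auto intro!: continuous_intros dest!: disc_coords(1) simp: abs_less_iff)
  moreover have "continuous_on (ball 0 1) (\<lambda>v::real^2. chord_fraction (v $ 1) (v $ 2))"
    unfolding chord_fraction_def
    by (intro continuous_intros continuous_on_compose2[OF continuous_half_chord[of UNIV]])
      (auto dest!: disc_coords(1) half_chord_pos)
  ultimately show ?thesis
    unfolding disc_to_square_def vector_2_eq by (intro continuous_intros)
qed

text \<open>Only the first coordinate is continuous on the closed disc: the second one is discontinuous
  at the two points where the chord degenerates, but it is a quotient of continuous functions.\<close>

lemma borel_disc_to_square: "disc_to_square \<in> borel_measurable (restrict_space borel (cball 0 1))"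
proof -
  have n: "\<bar>v $ 1\<bar> \<le> 1" if "norm v \<le> 1" for v :: "real ^ 2"
    using Finite_Cartesian_Product.norm_nth_le[of v 1] that by simp
  have "continuous_on (cball 0 1) (\<lambda>v::real^2. area_fraction (v $ 1))"
    by (rule continuous_on_compose2[OF continuous_area_fraction])
      (auto intro!: continuous_intros dest!: n simp: abs_le_iff)
  then have 1: "(\<lambda>v::real^2. area_fraction (v $ 1)) \<in> borel_measurable (restrict_space borel (cball 0 1))"
    by (rule borel_measurable_continuous_on_restrict)
  have hc: "half_chord \<in> borel_measurable borel"
    by (intro borel_measurable_continuous_onI continuous_half_chord)
  have nth: "(\<lambda>v::real^2. v $ i) \<in> borel_measurable borel" for i
    by (intro borel_measurable_continuous_onI continuous_intros)
  have "(\<lambda>v::real^2. chord_fraction (v $ 1) (v $ 2)) \<in> borel_measurable borel"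
    unfolding chord_fraction_def
    by (intro borel_measurable_divide borel_measurable_add borel_measurable_const nth
        measurable_compose[OF nth hc])
  then have 2: "(\<lambda>v::real^2. chord_fraction (v $ 1) (v $ 2)) \<in> borel_measurable (restrict_space borel (cball 0 1))"
    by (rule measurable_restrict_space1)
  have eq: "disc_to_square = (\<lambda>v. area_fraction (v $ 1) *\<^sub>R axis 1 1 + chord_fraction (v $ 1) (v $ 2) *\<^sub>R axis 2 1)"
    by (rule ext) (simp add: disc_to_square_def vector_2_eq)
  show ?thesis unfolding eq
    by (intro borel_measurable_add borel_measurable_scaleR 1 2 borel_measurable_const)
qed

text \<open>Two points of the open unit cube that agree modulo 1 differ by integers of absolute value
  less than 1.\<close>

lemma inj_torus_unit_cube:
  assumes "torus v = torus w" "\<And>i. 0 < v $ i \<and> v $ i < 1" "\<And>i. 0 < w $ i \<and> w $ i < 1"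
  shows "v = w"
proof -
  have "v $ i = w $ i" for i
  proof -
    have "torus v $ i = torus w $ i" using assms(1) by simp
    then have "cis (2 * pi * v $ i) = cis (2 * pi * w $ i)" by (simp add: torus_def)
    then have "cis (2 * pi * (v $ i - w $ i)) = 1"
      by (simp add: right_diff_distrib flip: cis_divide)
    then have "cos (2 * pi * (v $ i - w $ i)) = 1" by (simp add: complex_eq_iff)
    then obtain n :: int where "2 * pi * (v $ i - w $ i) = real_of_int n * 2 * pi"
      by (auto simp: cos_one_2pi_int)
    then have n: "v $ i - w $ i = real_of_int n" by simp
    with assms(2,3)[of i] have "real_of_int n < 1" "real_of_int n > -1" by linarith+
    then have "n = 0" by linarith
    with n show ?thesis by simp
  qed
  then show ?thesis by (simp add: vec_eq_iff)
qed

lemma inj_torus_disc_to_square: "inj_on (\<lambda>v. torus (disc_to_square v)) (ball 0 1)"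
proof (rule inj_onI)
  fix v w :: "real ^ 2" assume v: "v \<in> ball 0 1" and w: "w \<in> ball 0 1"
    and eq: "torus (disc_to_square v) = torus (disc_to_square w)"
  have b: "0 < disc_to_square u $ i \<and> disc_to_square u $ i < 1" if "u \<in> ball 0 1" for u i
    using area_fraction_bounds[OF disc_coords(1)[OF that]] chord_fraction_bounds[OF disc_coords(2)[OF that]]
      exhaust_2[of i] by (auto simp: disc_to_square_def)
  have e: "disc_to_square v = disc_to_square w"
    by (rule inj_torus_unit_cube[OF eq b[OF v] b[OF w]])
  then have "disc_to_square v $ i = disc_to_square w $ i" for i by simp
  from this[of 1] this[of 2] have e1: "area_fraction (v $ 1) = area_fraction (w $ 1)"
    and e2: "chord_fraction (v $ 1) (v $ 2) = chord_fraction (w $ 1) (w $ 2)"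
    by (simp_all add: disc_to_square_def)
  have 1: "v $ 1 = w $ 1"
    using area_fraction_strict_mono[of "v $ 1" "w $ 1"] area_fraction_strict_mono[of "w $ 1" "v $ 1"]
      disc_coords(1)[OF v] disc_coords(1)[OF w] e1 by (smt (verit))
  have "v $ 2 = w $ 2"
    using e2 half_chord_pos[OF disc_coords(1)[OF w]] by (simp add: 1 chord_fraction_def)
  with 1 show "v = w" by (simp add: vec_eq_iff forall_2)
qed

section \<open>Orthogonality\<close>

lemma cis_int: "m \<in> \<int> \<Longrightarrow> cis (2 * pi * m) = 1"
  by (auto elim!: Ints_cases simp: cis_multiple_2pi)

lemma has_vector_derivative_cis_scaled:
  assumes "(g has_real_derivative g') (at x)"
  shows "((\<lambda>x. cis (c * g x)) has_vector_derivative (\<i> * of_real (c * g') * cis (c * g x))) (at x)"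
proof -
  have "((\<lambda>x. \<i> * of_real (c * g x)) has_vector_derivative \<i> * of_real (c * g')) (at x)"
    by (intro has_vector_derivative_mult_right has_vector_derivative_of_real
        has_real_derivative_iff_has_vector_derivative[THEN iffD1] DERIV_cmult assms)
  from field_vector_diff_chain_at[OF this DERIV_exp]
  have "((\<lambda>x. exp (\<i> * of_real (c * g x))) has_vector_derivative
      (\<i> * of_real (c * g') * exp (\<i> * of_real (c * g x)))) (at x)"
    by (simp only: o_def)
  then show ?thesis by (simp add: cis_conv_exp)
qed

lemma exp_system_disc:
  "exp_system disc_to_square l (vector [x, y]) =
     cis (2 * pi * l $ 1 * area_fraction x) * cis (2 * pi * l $ 2 * chord_fraction x y)"
  by (simp add: exp_system_cis inner_vec_def sum_2 disc_to_square_def cis_mult algebra_simps)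

text \<open>The chord fraction is affine in \<open>y\<close> and runs from 0 to 1, so unless \<open>b\<close> is zero
  the exponential runs through \<open>\<bar>b\<bar>\<close> full periods at constant speed.\<close>

lemma chord_integral:
  assumes x: "\<bar>x\<bar> < 1" and b: "b \<in> \<int>"
  shows "(LINT y|lborel. indicator {- half_chord x<..<half_chord x} y *\<^sub>R cis (2 * pi * b * chord_fraction x y)) =
    (if b = 0 then of_real (2 * half_chord x) else 0)"
proof (cases "b = 0")
  case True
  have "(LINT y|lborel. indicator {- half_chord x<..<half_chord x} y *\<^sub>R (1::complex)) =
    of_real (half_chord x) - of_real (- half_chord x)"
    by (rule integral_lborel_open_interval_FTC)
      (use half_chord_pos[OF x] in \<open>auto intro!: continuous_intros derivative_eq_intros\<close>)
  then show ?thesis using True by simp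
next
  case False
  let ?s = "half_chord x"
  have s: "?s > 0" using x by (rule half_chord_pos)
  \<comment> \<open>the logarithmic derivative of the integrand, hence the divisor that makes an antiderivative\<close>
  define k where "k = \<i> * of_real (2 * pi * b * (1 / (2 * ?s)))"
  have k: "k \<noteq> 0" using False s by (simp add: k_def)
  let ?f = "\<lambda>y. cis (2 * pi * b * chord_fraction x y)"
  have cont: "continuous_on A (chord_fraction x)" for A
    unfolding chord_fraction_def using s by (intro continuous_intros) auto
  have "(LINT y|lborel. indicator {- ?s<..<?s} y *\<^sub>R ?f y) = ?f ?s / k - ?f (- ?s) / k"
  proof (rule integral_lborel_open_interval_FTC)
    fix y
    have "(chord_fraction x has_real_derivative 1 / (2 * ?s)) (at y)"
      unfolding chord_fraction_def[abs_def] using s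
      by (auto intro!: derivative_eq_intros simp: field_simps)
    from has_vector_derivative_divide[OF has_vector_derivative_cis_scaled[OF this], of "2 * pi * b" k]
    show "((\<lambda>y. ?f y / k) has_vector_derivative ?f y) (at y)"
      using k by (simp add: k_def)
  qed (use s in \<open>auto intro!: continuous_intros cont simp: k\<close>)
  moreover have "?f ?s = ?f (- ?s)"
    using s b by (simp add: chord_fraction_def cis_int)
  ultimately show ?thesis using False by simp
qed

text \<open>The chord length \<open>2 * half_chord x\<close> left over from the inner integral is exactly the
  derivative of the area fraction up to the factor \<open>pi\<close>, so the integrand has the exponential itself as
  an antiderivative up to a constant, with equal values at both ends.\<close>

lemma area_integral:
  assumes a: "a \<in> \<int>" "a \<noteq> 0"
  shows "(LINT x|lborel. indicator {-1<..<1} x *\<^sub>R (cis (2 * pi * a * area_fraction x) * of_real (2 * half_chord x))) = 0"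
proof -
  \<comment> \<open>the derivative of the exponential is \<open>k\<close> times the integrand\<close>
  define k where "k = \<i> * of_real (2 * pi * a / pi)"
  have k: "k \<noteq> 0" using a by (simp add: k_def)
  let ?F = "\<lambda>x. cis (2 * pi * a * area_fraction x) / k"
  have "(LINT x|lborel. indicator {-1<..<1} x *\<^sub>R (cis (2 * pi * a * area_fraction x) * of_real (2 * half_chord x)))
    = ?F 1 - ?F (-1)"
  proof (rule integral_lborel_open_interval_FTC)
    fix x :: real assume "x \<in> {-1<..<1}"
    then have "\<bar>x\<bar> < 1" by auto
    from has_vector_derivative_divide[OF has_vector_derivative_cis_scaled[OF area_fraction_deriv[OF this]], of "2 * pi * a" k]
    show "(?F has_vector_derivative cis (2 * pi * a * area_fraction x) * of_real (2 * half_chord x)) (at x)"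
      using k by (simp add: k_def field_simps)
  qed (auto intro!: continuous_intros continuous_area_fraction continuous_half_chord simp: k)
  also have "\<dots> = 0" using a by (simp add: area_fraction_ends cis_int)
  finally show ?thesis .
qed

text \<open>By Fubini: if the second frequency is not zero, every chord contributes zero. Otherwise
  the inner integral gives the chord length and the outer integral vanishes.\<close>

lemma integral_exp_system_disc:
  assumes l: "l \<in> int_lattice" "l \<noteq> 0"
  shows "(LINT v|lebesgue_on (ball 0 1). exp_system disc_to_square l v) = 0"
proof -
  have li: "l $ 1 \<in> \<int>" "l $ 2 \<in> \<int>" using l(1) by (auto simp: int_lattice_def)
  let ?A = "\<lambda>x. cis (2 * pi * l $ 1 * area_fraction x)"
  let ?C = "\<lambda>x y. cis (2 * pi * l $ 2 * chord_fraction x y)"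
  have "continuous_on (ball 0 1) (exp_system disc_to_square l)"
    unfolding exp_system_cis by (intro continuous_intros continuous_disc_to_square)
  then have "(LINT v|lebesgue_on (ball 0 1). exp_system disc_to_square l v) =
    (LINT x|lborel. LINT y|lborel. indicator {y. x\<^sup>2 + y\<^sup>2 < 1} y *\<^sub>R exp_system disc_to_square l (vector [x, y]))"
    by (rule integral_disc_iterated[where B = 1]) simp
  also have "(\<lambda>x. LINT y|lborel. indicator {y. x\<^sup>2 + y\<^sup>2 < 1} y *\<^sub>R exp_system disc_to_square l (vector [x, y])) =
     (\<lambda>x. indicator {-1<..<1} x *\<^sub>R (?A x * (if l $ 2 = 0 then of_real (2 * half_chord x) else 0)))"
    (is "?I = ?J")
  proof
    fix x
    have set: "{y. x\<^sup>2 + y\<^sup>2 < 1} = {- half_chord x<..<half_chord x}"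
      by (auto simp: abs_less_sqrt half_chord_def)
    show "?I x = ?J x"
    proof (cases "\<bar>x\<bar> < 1")
      case True
      have "?I x = (LINT y|lborel. ?A x * (indicator {- half_chord x<..<half_chord x} y *\<^sub>R ?C x y))"
        unfolding set exp_system_disc by (intro Bochner_Integration.integral_cong) auto
      also have "\<dots> = ?A x * (LINT y|lborel. indicator {- half_chord x<..<half_chord x} y *\<^sub>R ?C x y)"
        by (rule integral_mult_right_zero)
      also have "\<dots> = ?J x"
        unfolding chord_integral[OF True li(2)] using True by (auto simp: indicator_def)
      finally show ?thesis .
    next
      case False
      then have "1 \<le> x\<^sup>2" by (simp add: abs_square_less_1 flip: not_less)
      then have "half_chord x \<le> 0" by (simp add: half_chord_def)
      then have "{- half_chord x<..<half_chord x} = {}" by auto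
      then show ?thesis using False unfolding set by (auto simp: indicator_def)
    qed
  qed
  also have "(LINT x|lborel. ?J x) = 0"
  proof (cases "l $ 2 = 0")
    case True
    then have "l $ 1 \<noteq> 0" using l(2) by (auto simp: vec_eq_iff forall_2)
    with True show ?thesis using area_integral[OF li(1)] by simp
  qed simp
  finally show ?thesis .
qed

section \<open>The orthogonal basis\<close>

theorem proposition4p4:
  shows "\<exists>(\<phi> :: real ^ 2 \<Rightarrow> real ^ 2) (\<Lambda> :: (real ^ 2) set).
    \<phi> \<in> borel_measurable (restrict_space borel (cball 0 1)) \<and>
    countable \<Lambda> \<and> discrete \<Lambda> \<and>
    orthogonal_basis_L2 (lebesgue_on (ball 0 1)) \<Lambda> (exp_system \<phi>)"
proof -
  let ?D = "ball (0 :: real ^ 2) 1"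
  let ?e = "exp_system disc_to_square"
  have fin: "finite_measure (lebesgue_on ?D)"
    by (rule finite_measure_lebesgue_on) (rule lmeasurable_ball)
  interpret finite_measure "lebesgue_on ?D" by (rule fin)
  have cont: "continuous_on ?D (?e l)" for l
    unfolding exp_system_cis by (intro continuous_intros continuous_disc_to_square)
  have torus_cont: "continuous_on ?D (\<lambda>v. torus (disc_to_square v))"
    unfolding torus_def by (intro continuous_intros continuous_disc_to_square)
  have L2: "?e l \<in> L2_space (lebesgue_on ?D)" for l
    using continuous_imp_measurable_on_sets_lebesgue[OF cont] by (simp add: L2_space_def)
  have "measure lebesgue ?D > 0"
    using content_ball_pos[of 1 "0 :: real ^ 2"] by simp
  then have norm: "l2_norm (lebesgue_on ?D) (?e l) \<noteq> 0" for l
    by (simp add: l2_norm_def measure_restrict_space)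
  have orth: "l2_inner (lebesgue_on ?D) (?e l) (?e m) = 0"
    if "l \<in> int_lattice" "m \<in> int_lattice" "l \<noteq> m" for l m
    using integral_exp_system_disc[OF int_lattice_diff[OF that(1,2)]] that(3)
    by (simp add: l2_inner_def exp_system_diff)
  have dense: "\<exists>F c. finite F \<and> F \<subseteq> int_lattice \<and>
      l2_norm (lebesgue_on ?D) (\<lambda>v. f v - (\<Sum>l\<in>F. c l * ?e l v)) < \<epsilon>"
    if f: "f \<in> L2_space (lebesgue_on ?D)" and \<epsilon>: "0 < \<epsilon>" for f \<epsilon>
  proof -
    obtain P where P: "trig_poly disc_to_square P" "l2_norm (lebesgue_on ?D) (\<lambda>v. f v - P v) < \<epsilon>"
      by (rule trig_poly_dense_L2[OF open_ball lmeasurable_ball torus_cont inj_torus_disc_to_square f \<epsilon>])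
    from trig_poly_eq_sum[OF P(1)] obtain F c where "finite F" "F \<subseteq> int_lattice"
      "\<And>v. P v = (\<Sum>l\<in>F. c l * ?e l v)" by auto
    with P(2) show ?thesis by (intro exI[of _ F] exI[of _ c]) simp
  qed
  have "orthogonal_basis_L2 (lebesgue_on ?D) int_lattice ?e"
    unfolding orthogonal_basis_L2_def by (intro conjI ballI allI impI L2 norm orth dense)
  then show ?thesis
    by (intro exI[of _ disc_to_square] exI[of _ int_lattice] conjI
        borel_disc_to_square countable_int_lattice discrete_int_lattice)
qed

end
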